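(* Consider a family of well-behaved objects in $\mathbb{R}^2$ such that the union of any $n$ objects of the family has complexity at most $\mathcal{U}(n)$, where $\mathcal{U}(n)/n$ is nondecreasing. Then the intersection graph of any $n$ objects from this family admits a $2$-hop spanner of size $O(\mathcal{U}(n)\log n)$.
   Context: "Well-behaved" is the technical regularity condition on families of planar regions from Chekuri, Clarkson and Har-Peled (2012) under which shallow cuttings exist (e.g., disks and pseudodisks are well-behaved); roughly, objects are closed regions bounded by simple closed curves whose boundaries pairwise intersect in a bounded number of points. The union complexity of a set of objects is the number of vertices and edges on the boundary of their union. The intersection graph has the objects as vertices, with an edge iff the two objects intersect. For a graph $G$ and integer $t\ge1$, a $t$-hop spanner is a subgraph $\widehat{G}$ of $G$ on the same vertex set such that for every edge $uv\in E(G)$ there is a $u$–$v$ path in $\widehat{G}$ with at most $t$ edges; its size is its number of edges. *)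

theory Defs
  imports "HOL-Analysis.Analysis"
begin

definition jordan_region :: "complex set \<Rightarrow> bool" where
  "jordan_region S \<longleftrightarrow>
     (\<exists>g. simple_path g \<and> pathfinish g = pathstart g \<and>
          S = path_image g \<union> inside (path_image g))"

definition well_behaved :: "complex set set \<Rightarrow> bool" where
  "well_behaved F \<longleftrightarrow>
     (\<forall>S\<in>F. jordan_region S) \<and>
     (\<exists>s::nat. \<forall>A\<in>F. \<forall>B\<in>F. A \<noteq> B \<longrightarrow>
          finite (frontier A \<inter> frontier B) \<and> card (frontier A \<inter> frontier B) \<le> s)"

definition union_vertices :: "complex set set \<Rightarrow> complex set" where
  "union_vertices X = {p \<in> frontier (\<Union>X).
      \<exists>A\<in>X. \<exists>B\<in>X. A \<noteq> B \<and> p \<in> frontier A \<and> p \<in> frontier B}"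

definition union_edges :: "complex set set \<Rightarrow> complex set set" where
  "union_edges X = components (frontier (\<Union>X) - union_vertices X)"

definition union_complexity_le :: "complex set set \<Rightarrow> real \<Rightarrow> bool" where
  "union_complexity_le X c \<longleftrightarrow>
     finite (union_vertices X) \<and> finite (union_edges X) \<and>
     real (card (union_vertices X) + card (union_edges X)) \<le> c"

definition intersection_graph_edges :: "'a set set \<Rightarrow> 'a set set set" where
  "intersection_graph_edges X =
     {{A, B} | A B. A \<in> X \<and> B \<in> X \<and> A \<noteq> B \<and> A \<inter> B \<noteq> {}}"

definition hop_spanner :: "nat \<Rightarrow> 'v set set \<Rightarrow> 'v set set \<Rightarrow> bool" where
  "hop_spanner t E H \<longleftrightarrow> H \<subseteq> E \<and>
     (\<forall>u v. {u, v} \<in> E \<longrightarrow>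
        (\<exists>p. p \<noteq> [] \<and> hd p = u \<and> last p = v \<and> length p \<le> t + 1 \<and>
             (\<forall>i. Suc i < length p \<longrightarrow> {p ! i, p ! Suc i} \<in> H)))"

end

theory Submission
  imports Defs "HOL-Combinatorics.Permutations"
begin

text \<open>
  Order the \<open>n\<close> objects at random. Join \<open>A\<close> to an earlier object \<open>C\<close> if some point of
  \<open>A \<inter> C\<close> lies in no other object up to and including \<open>C\<close>. This is a 2-hop spanner: if
  \<open>q \<in> A \<inter> B\<close>, then both \<open>A\<close> and \<open>B\<close> are joined to the first object that contains \<open>q\<close>.
  A pair of positions \<open>i < j\<close> spans an edge iff it is a pair of depth two in a random subfamily
  of size \<open>i + 2\<close>, and by symmetry it is a uniformly random pair of that subfamily. So if every
  \<open>m\<close> objects have \<open>O(U(m))\<close> pairs with a common point in no third object, then the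
  expected number of edges is \<open>O(U(n) log n)\<close>, a harmonic sum.

  For the bound on such pairs, a common point can be moved to a point on the boundary of an
  object \<open>D\<close> that lies, apart from \<open>D\<close>, in a set \<open>T\<close> of only one or two objects: otherwise the
  hole of the remaining objects around the point lies inside both objects of the pair, and a
  generic point on the boundary of the hole will do. For fixed \<open>D\<close> and \<open>|T|\<close>, consider these
  points in cyclic order on the boundary of \<open>D\<close>. In a random half of the objects, \<open>T\<close> is absent
  but \<open>D\<close> and some object covering the next point are present with constant probability; then the
  point of \<open>T\<close> lies on a union edge which no other such point shares. Hence the pairs
  \<open>(D, T)\<close> are charged to union edges, at constant expected cost.
\<close>

section \<open>Closed regions bounded by simple closed curves\<close>

lemma jordan_region_closed: "jordan_region S \<Longrightarrow> closed S"
  and jordan_region_bounded: "jordan_region S \<Longrightarrow> bounded S"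
proof -
  assume "jordan_region S"
  then obtain g where g: "simple_path g" "S = path_image g \<union> inside (path_image g)"
    by (auto simp: jordan_region_def)
  have c: "closed (path_image g)" "bounded (path_image g)"
    using g(1) closed_simple_path_image bounded_simple_path_image by auto
  show "closed S" unfolding g(2) using c closed_path_image_Un_inside g(1) by (meson simple_path_imp_path)
  show "bounded S" unfolding g(2) using c bounded_inside by auto
qed

text \<open>The inside of the curve is open, hence contained in the interior of \<open>S\<close>, so
  only points of the curve are left for the frontier.\<close>

lemma jordan_region_frontier_curve:
  assumes "jordan_region S"
  obtains g where "simple_path g" "pathfinish g = pathstart g" "frontier S \<subseteq> path_image g"
proof -
  obtain g where g: "simple_path g" "pathfinish g = pathstart g"
      "S = path_image g \<union> inside (path_image g)"
    using assms by (auto simp: jordan_region_def)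
  have "inside (path_image g) \<subseteq> interior S"
    by (metis closed_simple_path_image g(1,3) inf_sup_ord(4) interior_maximal open_inside)
  moreover have "frontier S \<subseteq> S"
    using assms jordan_region_closed frontier_subset_closed by blast
  ultimately have "frontier S \<subseteq> path_image g"
    using g(3) by (auto simp: frontier_def)
  with g that show thesis by blast
qed

lemma mem_frontier_Union_imp_mem_frontier:
  assumes "E \<in> S" "y \<in> E" "y \<in> frontier (\<Union>S)"
  shows "y \<in> frontier E"
proof -
  have "interior E \<subseteq> interior (\<Union>S)" using assms(1) by (intro interior_mono) auto
  then show ?thesis using assms(2,3) closure_subset[of E] unfolding frontier_def by blast
qed

section \<open>Cyclic order on a simple closed curve\<close>

text \<open>The parameters \<open>s1\<close> and \<open>s2\<close> cut the loop into two closed arcs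
  that meet only in \<open>g s1\<close> and \<open>g s2\<close>. A connected part of the loop that
  avoids both cut points stays within one arc, whereas \<open>g x\<close> and \<open>g z\<close> lie
  in different ones.\<close>

lemma simple_loop_separated:
  fixes g :: "real \<Rightarrow> 'a::t2_space"
  assumes g: "simple_path g" "pathfinish g = pathstart g"
    and s: "0 \<le> s1" "s1 \<le> s2" "s2 \<le> 1"
    and e: "connected e" "e \<subseteq> path_image g" "g s1 \<notin> e" "g s2 \<notin> e"
    and x: "x \<in> {s1..s2}" "g x \<in> e"
    and z: "z \<in> {0..1} - {s1..s2}" "g z \<in> e"
  shows False
proof -
  define K1 where "K1 = g ` {s1..s2}"
  define K2 where "K2 = g ` ({0..s1} \<union> {s2..1})"
  have cont: "continuous_on {0..1} g"
    using g(1) simple_path_imp_path path_def by blast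
  have img: "closed (g ` K)" if "compact K" "K \<subseteq> {0..1}" for K
    using compact_imp_closed[OF compact_continuous_image[OF continuous_on_subset[OF cont that(2)] that(1)]] .
  have cl: "closed K1" "closed K2"
    unfolding K1_def K2_def using s by (intro img compact_Un; auto)+
  have inj: "a = b \<or> a = 0 \<and> b = 1 \<or> a = 1 \<and> b = 0"
    if "a \<in> {0..1}" "b \<in> {0..1}" "g a = g b" for a b
    using g(1) that by (auto simp: simple_path_def loop_free_def)
  have "K1 \<inter> K2 \<subseteq> {g s1, g s2}"
  proof
    fix y assume y: "y \<in> K1 \<inter> K2"
    obtain a where "a \<in> {s1..s2}" "y = g a" using y by (auto simp: K1_def)
    moreover obtain b where "b \<in> {0..s1} \<union> {s2..1}" "y = g b"
      using y unfolding K2_def by blast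
    ultimately have ab: "a \<in> {s1..s2}" "b \<in> {0..s1} \<union> {s2..1}" "g a = y" "g b = y"
      by simp_all
    \<comment> \<open>The closing point of the loop does no harm: \<open>a = 0\<close> forces
      \<open>s1 = 0\<close>, and \<open>a = 1\<close> forces \<open>s2 = 1\<close>, so
      \<open>y\<close> is a cut point in these cases as well.\<close>
    then have "a = b \<or> a = 0 \<and> b = 1 \<or> a = 1 \<and> b = 0"
      using inj[of a b] s by auto
    then have "a = s1 \<or> a = s2" using ab s by auto
    then show "y \<in> {g s1, g s2}" using ab by auto
  qed
  then have "K1 \<inter> K2 \<inter> e = {}" using e by auto
  moreover have "e \<subseteq> K1 \<union> K2"
  proof -
    have "{0..1} = {s1..s2} \<union> ({0..s1} \<union> {s2..1})" using s by auto
    then have "path_image g = K1 \<union> K2"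
      unfolding K1_def K2_def path_image_def by (metis image_Un)
    then show ?thesis using e(2) by simp
  qed
  ultimately have "K1 \<inter> e = {} \<or> K2 \<inter> e = {}" using connected_closedD[OF e(1)] cl by blast
  moreover have "g x \<in> K1" "g z \<in> K2" using x z s by (auto simp: K1_def K2_def)
  ultimately show False using x z by auto
qed

text \<open>\<open>f\<close> is the next element of \<open>P\<close>, with the maximum wrapping
  around to the minimum. The conclusion says that \<open>f p\<close> lies in the half-open interval
  from \<open>p\<close> (excluded) to \<open>q\<close> (included) and \<open>f q\<close> outside it,
  which is how two successors separate \<open>p\<close> from \<open>q\<close> on a circle.\<close>

lemma cyclic_successor:
  fixes P :: "'a::linorder set"
  assumes "finite P"
  obtains f where "f ` P \<subseteq> P"
    "\<And>p q. p \<in> P \<Longrightarrow> q \<in> P \<Longrightarrow> p < q \<Longrightarrow> p < f p \<and> f p \<le> q \<and> (q < f q \<or> f q \<le> p)"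
proof -
  define f where "f p = (if {q\<in>P. p < q} = {} then Min P else Min {q\<in>P. p < q})" for p
  have *: "f p \<in> {q\<in>P. p < q}" "\<And>q. q \<in> P \<Longrightarrow> p < q \<Longrightarrow> f p \<le> q" if "{q\<in>P. p < q} \<noteq> {}" for p
    using that assms Min_in[of "{q\<in>P. p < q}"] unfolding f_def by (auto intro: Min_le)
  have **: "f p = Min P" if "{q\<in>P. p < q} = {}" for p
    using that by (auto simp: f_def)
  show thesis
  proof
    show "f ` P \<subseteq> P"
    proof
      fix y assume "y \<in> f ` P"
      then obtain p where "p \<in> P" "y = f p" by auto
      then show "y \<in> P" using *(1)[of p] **[of p] Min_in[OF assms] by (cases "{q\<in>P. p < q} = {}") auto
    qed
    fix p q assume pq: "p \<in> P" "q \<in> P" "p < q"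
    then have "{q\<in>P. p < q} \<noteq> {}" by auto
    from *[OF this] pq have "p < f p" "f p \<le> q" by auto
    moreover have "q < f q \<or> f q \<le> p"
      using *(1)[of q] **[of q] assms pq(1) by (cases "{r\<in>P. q < r} = {}") auto
    ultimately show "p < f p \<and> f p \<le> q \<and> (q < f q \<or> f q \<le> p)" by blast
  qed
qed

text \<open>If \<open>p < q\<close>, then cutting the loop at \<open>f p\<close> and
  \<open>f q\<close> puts \<open>p\<close> and \<open>q\<close> on different arcs, so a connected
  \<open>e\<close> that avoids both cuts cannot contain both \<open>g p\<close> and
  \<open>g q\<close>.\<close>

lemma loop_blocked_by_successors:
  fixes f :: "real \<Rightarrow> real" and g :: "real \<Rightarrow> 'a::t2_space"
  assumes g: "simple_path g" "pathfinish g = pathstart g"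
    and P: "P \<subseteq> {0..1}" "f ` P \<subseteq> P"
      "\<And>p q. p \<in> P \<Longrightarrow> q \<in> P \<Longrightarrow> p < q \<Longrightarrow> p < f p \<and> f p \<le> q \<and> (q < f q \<or> f q \<le> p)"
    and e: "connected e" "e \<subseteq> path_image g"
    and pq: "p \<in> P" "q \<in> P" "g p \<in> e" "g q \<in> e" "g (f p) \<notin> e" "g (f q) \<notin> e"
  shows "p = q"
proof -
  have False if "p \<in> P" "q \<in> P" "p < q" "g p \<in> e" "g q \<in> e" "g (f p) \<notin> e" "g (f q) \<notin> e" for p q
  proof -
    have "f p \<in> P" "f q \<in> P" using that P(2) by auto
    then have f01: "f p \<in> {0..1}" "f q \<in> {0..1}" "p \<in> {0..1}" "q \<in> {0..1}" using that P(1) by blast+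
    have h: "p < f p" "f p \<le> q" "q < f q \<or> f q \<le> p" using P(3)[OF that(1-3)] by auto
    from h(3) show False
    proof
      assume "q < f q"
      then show False
        using simple_loop_separated[OF g, of "f p" "f q" e q p] e that f01 h by auto
    next
      \<comment> \<open>Here the successor of \<open>q\<close> wraps around: the arc from
        \<open>f q\<close> to \<open>f p\<close> contains \<open>p\<close>, and it misses
        \<open>q\<close> because \<open>f p\<close> differs from \<open>q\<close>.\<close>
      assume "f q \<le> p"
      moreover have "f p \<noteq> q" using that by auto
      ultimately show False
        using simple_loop_separated[OF g, of "f q" "f p" e p q] e that f01 h by auto
    qed
  qed
  then show ?thesis using pq by (metis linorder_less_linear)
qed

section \<open>Counting covered boundary points through random subsets\<close>

text \<open>Divided by \<open>2 ^ card S\<close>, this is the probability that a uniformly random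
  subset of \<open>S\<close> keeps all of \<open>K\<close> and drops all of
  \<open>L\<close>.\<close>

lemma card_subsets_containing_avoiding:
  assumes "finite S" "K \<subseteq> S" "L \<subseteq> S" "K \<inter> L = {}"
  shows "card {R. R \<subseteq> S \<and> K \<subseteq> R \<and> R \<inter> L = {}} = 2 ^ (card S - card K - card L)"
proof -
  have "bij_betw (\<lambda>R. R \<union> K) (Pow (S - K - L)) {R. R \<subseteq> S \<and> K \<subseteq> R \<and> R \<inter> L = {}}"
    by (rule bij_betw_byWitness[where f' = "\<lambda>R. R - K"]) (use assms in auto)
  from bij_betw_same_card[OF this]
  have "card {R. R \<subseteq> S \<and> K \<subseteq> R \<and> R \<inter> L = {}} = card (Pow (S - K - L))" by simp
  also have "\<dots> = 2 ^ card (S - K - L)" using assms by (simp add: card_Pow)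
  also have "card (S - K - L) = card S - card K - card L"
  proof -
    have "finite K" "finite L" using assms finite_subset by blast+
    then have "card (S - (K \<union> L)) = card S - (card K + card L)"
      using assms by (simp add: card_Diff_subset card_Un_disjoint)
    then show ?thesis by (simp add: Diff_eq Int_assoc)
  qed
  finally show ?thesis .
qed

text \<open>An edge contains no vertex, so \<open>frontier D\<close> and the union of the other
  frontiers cut it into two disjoint closed parts. By connectedness one part is empty, and
  \<open>y\<close> tells which.\<close>

lemma union_edge_in_frontier:
  assumes fin: "finite S" and e: "e \<in> union_edges S" and y: "D \<in> S" "y \<in> e" "y \<in> frontier D"
  shows "e \<subseteq> frontier D"
proof -
  have c: "connected e" "e \<subseteq> frontier (\<Union>S) - union_vertices S"
    using e in_components_connected in_components_subset unfolding union_edges_def by blast+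
  let ?B = "\<Union>E\<in>S - {D}. frontier E"
  have "e \<subseteq> frontier D \<union> ?B" using c frontier_Union_subset[OF fin] by blast
  moreover have "frontier D \<inter> ?B \<inter> e = {}" using c y by (auto simp: union_vertices_def)
  moreover have "closed ?B" using fin by auto
  ultimately have "frontier D \<inter> e = {} \<or> ?B \<inter> e = {}"
    using connected_closedD[OF c(1)] by blast
  then show ?thesis using y \<open>e \<subseteq> frontier D \<union> ?B\<close> by blast
qed

text \<open>Fixing the size \<open>c\<close> makes distinct members incomparable under inclusion, so
  each of two members has an object outside the other. This supplies the blockers below.\<close>

definition boundary_depth_sets :: "complex set set \<Rightarrow> nat \<Rightarrow> complex set \<Rightarrow> complex set set set" where
  "boundary_depth_sets S c D =
     {T. T \<subseteq> S - {D} \<and> card T = c \<and> (\<exists>y\<in>frontier D. {E\<in>S. y \<in> E} = insert D T)}"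

lemma finite_boundary_depth_sets:
  assumes "finite S"
  shows "finite (boundary_depth_sets S c D)"
proof -
  have "boundary_depth_sets S c D \<subseteq> Pow S" unfolding boundary_depth_sets_def by blast
  then show ?thesis using assms by (simp add: finite_subset)
qed

text \<open>Each \<open>T\<close> gets one point on the boundary curve of \<open>D\<close>. When
  \<open>R\<close> contains \<open>D\<close> and drops \<open>T\<close>, that point lies on a union
  edge within \<open>frontier D\<close>. When \<open>R\<close> also contains the blocker
  \<open>b T\<close>, the edge cannot reach the next point on the curve, so different
  \<open>T\<close> occupy different edges.\<close>

lemma union_edge_blockers:
  assumes fin: "finite S" and jr: "\<And>E. E \<in> S \<Longrightarrow> jordan_region E" and D: "D \<in> S"
  obtains b where "\<And>T. T \<in> boundary_depth_sets S c D \<Longrightarrow> b T \<in> S - T"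
    "\<And>R. R \<subseteq> S \<Longrightarrow> D \<in> R \<Longrightarrow> finite (union_edges R) \<Longrightarrow>
       card {T\<in>boundary_depth_sets S c D. T \<inter> R = {} \<and> b T \<in> R}
         \<le> card {e\<in>union_edges R. e \<subseteq> frontier D}"
proof -
  define I where "I = boundary_depth_sets S c D"
  obtain g where g: "simple_path g" "pathfinish g = pathstart g" "frontier D \<subseteq> path_image g"
    using jordan_region_frontier_curve jr D by blast
  have "\<forall>T\<in>I. \<exists>t. t \<in> {0..1} \<and> g t \<in> frontier D \<and> {E\<in>S. g t \<in> E} = insert D T"
  proof
    fix T assume T: "T \<in> I"
    obtain y where y: "y \<in> frontier D" "{E\<in>S. y \<in> E} = insert D T"
      using T unfolding I_def boundary_depth_sets_def by blast
    obtain t where "t \<in> {0..1}" "y = g t" using y(1) g(3) unfolding path_image_def by blast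
    with y show "\<exists>t. t \<in> {0..1} \<and> g t \<in> frontier D \<and> {E\<in>S. g t \<in> E} = insert D T"
      by blast
  qed
  from bchoice[OF this] obtain t where t: "\<And>T. T \<in> I \<Longrightarrow> t T \<in> {0..1}" "\<And>T. T \<in> I \<Longrightarrow> g (t T) \<in> frontier D"
      "\<And>T. T \<in> I \<Longrightarrow> {E\<in>S. g (t T) \<in> E} = insert D T"
    by blast
  have TD: "D \<notin> T" "T \<subseteq> S" "card T = c" if "T \<in> I" for T
    using that by (auto simp: I_def boundary_depth_sets_def)
  have finI: "finite I" using fin finite_boundary_depth_sets by (simp add: I_def)
  \<comment> \<open>The point determines the objects covering it, which are \<open>D\<close> and
    \<open>T\<close>.\<close>
  have inj: "inj_on t I"
    by (rule inj_onI) (metis t(3) TD(1) insert_ident)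
  obtain f where f: "f ` (t ` I) \<subseteq> t ` I"
    "\<And>p q. p \<in> t ` I \<Longrightarrow> q \<in> t ` I \<Longrightarrow> p < q \<Longrightarrow> p < f p \<and> f p \<le> q \<and> (q < f q \<or> f q \<le> p)"
    using cyclic_successor[of "t ` I"] finI by blast
  have "\<forall>T\<in>I. \<exists>T'. T' \<in> I \<and> f (t T) = t T'" using f(1) by blast
  from bchoice[OF this] obtain nx
    where nx: "\<And>T. T \<in> I \<Longrightarrow> nx T \<in> I" "\<And>T. T \<in> I \<Longrightarrow> f (t T) = t (nx T)"
    by blast
  \<comment> \<open>An object covering the next point but not that of \<open>T\<close>; if \<open>T\<close> is alone, \<open>D\<close> serves as a dummy.\<close>
  define b where "b T = (if nx T = T then D else SOME E. E \<in> nx T - T)" for T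
  have b1: "b T \<in> nx T - T" if "T \<in> I" "nx T \<noteq> T" for T
  proof -
    have "\<not> nx T \<subseteq> T"
      using that nx TD fin by (metis card_subset_eq finite_subset)
    then have "\<exists>E. E \<in> nx T - T" by auto
    from someI_ex[OF this] show ?thesis using that by (simp add: b_def)
  qed
  have bS: "b T \<in> S - T" if "T \<in> I" for T
  proof (cases "nx T = T")
    case True
    then show ?thesis using TD that D by (simp add: b_def)
  next
    case False
    then show ?thesis using b1 that nx TD by blast
  qed
  have "card {T\<in>I. T \<inter> R = {} \<and> b T \<in> R} \<le> card {e\<in>union_edges R. e \<subseteq> frontier D}"
    if R: "R \<subseteq> S" "D \<in> R" "finite (union_edges R)" for R
  proof -
    define G where "G = {T\<in>I. T \<inter> R = {} \<and> b T \<in> R}"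
    have finR: "finite R" using R fin finite_subset by blast
    have "\<forall>T\<in>G. \<exists>e. e \<in> union_edges R \<and> g (t T) \<in> e"
    proof
      fix T assume T: "T \<in> G"
      have TI: "T \<in> I" and TR: "T \<inter> R = {}" using T by (auto simp: G_def)
      let ?y = "g (t T)"
      have only: "E = D" if "E \<in> R" "?y \<in> E" for E
        using t(3)[OF TI] that TR R by blast
      have cl: "closed E" if "E \<in> R" for E using jr that R jordan_region_closed by blast
      have "?y \<in> D" using t(3)[OF TI] D by auto
      \<comment> \<open>Near this point the union of \<open>R\<close> coincides with
        \<open>D\<close>, and the point is on the frontier of \<open>D\<close>.\<close>
      moreover have "?y \<notin> interior (\<Union>R)"
      proof
        assume "?y \<in> interior (\<Union>R)"
        moreover have "?y \<in> - \<Union>(R - {D})" using only by auto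
        moreover have "open (- \<Union>(R - {D}))"
          using finR cl by (intro open_Compl closed_Union) auto
        moreover have "interior (\<Union>R) \<inter> - \<Union>(R - {D}) \<subseteq> D"
          using interior_subset[of "\<Union>R"] by blast
        ultimately have "?y \<in> interior D"
          by (metis IntI interior_maximal open_Int open_interior subsetD)
        then show False using t(2)[OF TI] by (auto simp: frontier_def)
      qed
      ultimately have "?y \<in> frontier (\<Union>R)"
        using R closure_subset[of "\<Union>R"] by (auto simp: frontier_def)
      moreover have "?y \<notin> union_vertices R"
      proof
        assume "?y \<in> union_vertices R"
        then obtain A B where "A \<in> R" "B \<in> R" "A \<noteq> B" "?y \<in> frontier A" "?y \<in> frontier B"
          by (auto simp: union_vertices_def)
        then show False using only cl frontier_subset_closed by (metis subsetD)
      qed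
      ultimately have "?y \<in> \<Union>(union_edges R)" by (simp add: union_edges_def)
      then show "\<exists>e. e \<in> union_edges R \<and> g (t T) \<in> e" by blast
    qed
    from bchoice[OF this] obtain h
      where h: "\<And>T. T \<in> G \<Longrightarrow> h T \<in> union_edges R" "\<And>T. T \<in> G \<Longrightarrow> g (t T) \<in> h T"
      by blast
    have hD: "h T \<subseteq> frontier D" if "T \<in> G" for T
      using union_edge_in_frontier[OF finR h(1) R(2) h(2) t(2)] that by (auto simp: G_def)
    \<comment> \<open>The next point lies on \<open>frontier D\<close> and in \<open>b T\<close>. If
      it were on a union edge, it would be on \<open>frontier (b T)\<close> too and thus a union
      vertex, but edges contain no vertices.\<close>
    have blocked: "g (f (t T)) \<notin> e" if T: "T \<in> G" "nx T \<noteq> T" and e: "e \<in> union_edges R" for T e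
    proof
      have TI: "T \<in> I" and bR: "b T \<in> R" using T by (auto simp: G_def)
      let ?y = "g (t (nx T))"
      assume "g (f (t T)) \<in> e"
      then have "?y \<in> e" using nx TI by simp
      then have y: "?y \<in> frontier (\<Union>R)" "?y \<notin> union_vertices R"
        using e in_components_subset by (auto simp: union_edges_def)
      have "?y \<in> b T" using t(3)[OF nx(1)[OF TI]] b1[OF TI T(2)] by auto
      then have "?y \<in> frontier (b T)" using mem_frontier_Union_imp_mem_frontier bR y by blast
      moreover have "?y \<in> frontier D" using t(2) nx TI by auto
      moreover have "b T \<noteq> D" using b1[OF TI T(2)] TD(1)[OF nx(1)[OF TI]] by auto
      ultimately show False using y R bR by (auto simp: union_vertices_def)
    qed
    have "inj_on h G"
    proof (rule inj_onI)
      fix T T' assume TT: "T \<in> G" "T' \<in> G" "h T = h T'"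
      then have I: "T \<in> I" "T' \<in> I" by (auto simp: G_def)
      show "T = T'"
      proof (rule ccontr)
        assume ne: "T \<noteq> T'"
        then have "t T \<noteq> t T'" using inj I by (auto dest: inj_onD)
        \<comment> \<open>As soon as there are two points, the cyclic successor has no fixed point,
          so the dummy value of \<open>b\<close> does not occur here.\<close>
        then have nt: "nx T \<noteq> T \<and> nx T' \<noteq> T'"
          using f(2)[of "t T" "t T'"] f(2)[of "t T'" "t T"] nx(2)[OF I(1)] nx(2)[OF I(2)] I
          by (metis imageI leD linorder_less_linear order_less_irrefl)
        have "t T = t T'"
        proof (rule loop_blocked_by_successors[OF g(1,2) _ f])
          show "t ` I \<subseteq> {0..1}" using t(1) by blast
          show "connected (h T)"
            using h(1)[OF TT(1)] in_components_connected by (auto simp: union_edges_def)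
          show "h T \<subseteq> path_image g" using hD TT g(3) by blast
          show "t T \<in> t ` I" "t T' \<in> t ` I" using I by auto
          show "g (t T) \<in> h T" "g (t T') \<in> h T" using h(2) TT by auto
          show "g (f (t T)) \<notin> h T" "g (f (t T')) \<notin> h T" using blocked TT nt h by auto
        qed
        then show False using \<open>t T \<noteq> t T'\<close> by simp
      qed
    qed
    moreover have "h ` G \<subseteq> {e\<in>union_edges R. e \<subseteq> frontier D}" using h hD by auto
    ultimately show ?thesis using R(3) unfolding G_def[symmetric]
      by (metis (no_types, lifting) card_inj_on_le finite_subset mem_Collect_eq subsetI)
  qed
  with bS show thesis by (intro that[of b]) (auto simp: I_def)
qed

text \<open>Average over all subsets \<open>R\<close> of \<open>S\<close>. A pair
  \<open>(D, T)\<close> prescribes the presence of at most two objects and the absence of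
  \<open>c\<close>, so at least a fraction \<open>1 / 2 ^ (c + 2)\<close> of the subsets is good for
  it. A single \<open>R\<close> is good for at most \<open>u\<close> pairs. The empty
  \<open>R\<close> is set apart because the growth condition on \<open>U\<close> starts at one
  object.\<close>

lemma card_boundary_depth_sets_le:
  fixes u :: real
  assumes fin: "finite S" and jr: "\<And>E. E \<in> S \<Longrightarrow> jordan_region E"
    and u: "\<And>R. R \<subseteq> S \<Longrightarrow> finite (union_edges R)" "0 \<le> u"
      "\<And>R. R \<subseteq> S \<Longrightarrow> R \<noteq> {} \<Longrightarrow> real (card (union_edges R)) \<le> u"
  shows "real (\<Sum>D\<in>S. card (boundary_depth_sets S c D)) \<le> 2 ^ (c + 2) * u"
proof -
  let ?I = "boundary_depth_sets S c"
  let ?n = "card S"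
  have "\<forall>D\<in>S. \<exists>b. (\<forall>T\<in>?I D. b T \<in> S - T) \<and> (\<forall>R. R \<subseteq> S \<longrightarrow> D \<in> R \<longrightarrow>
       card {T\<in>?I D. T \<inter> R = {} \<and> b T \<in> R} \<le> card {e\<in>union_edges R. e \<subseteq> frontier D})"
  proof
    fix D assume "D \<in> S"
    from union_edge_blockers[OF fin jr this, of c] obtain b
      where "\<And>T. T \<in> ?I D \<Longrightarrow> b T \<in> S - T"
        "\<And>R. R \<subseteq> S \<Longrightarrow> D \<in> R \<Longrightarrow> finite (union_edges R) \<Longrightarrow>
          card {T\<in>?I D. T \<inter> R = {} \<and> b T \<in> R} \<le> card {e\<in>union_edges R. e \<subseteq> frontier D}"
      by blast
    with u(1) show "\<exists>b. (\<forall>T\<in>?I D. b T \<in> S - T) \<and> (\<forall>R. R \<subseteq> S \<longrightarrow> D \<in> R \<longrightarrow>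
       card {T\<in>?I D. T \<inter> R = {} \<and> b T \<in> R} \<le> card {e\<in>union_edges R. e \<subseteq> frontier D})"
      by (intro exI[of _ b]) simp
  qed
  from bchoice[OF this] obtain b where
    b0: "\<forall>D\<in>S. (\<forall>T\<in>?I D. b D T \<in> S - T) \<and> (\<forall>R. R \<subseteq> S \<longrightarrow> D \<in> R \<longrightarrow>
       card {T\<in>?I D. T \<inter> R = {} \<and> b D T \<in> R} \<le> card {e\<in>union_edges R. e \<subseteq> frontier D})"
    by (rule exE)
  have b: "\<And>D T. D \<in> S \<Longrightarrow> T \<in> ?I D \<Longrightarrow> b D T \<in> S - T"
     "\<And>D R. R \<subseteq> S \<Longrightarrow> D \<in> R \<Longrightarrow>
       card {T\<in>?I D. T \<inter> R = {} \<and> b D T \<in> R} \<le> card {e\<in>union_edges R. e \<subseteq> frontier D}"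
    using b0 by blast+
  have fI: "finite (?I D)" for D using finite_boundary_depth_sets[OF fin] .
  define good where "good D T R \<longleftrightarrow> {D, b D T} \<subseteq> R \<and> R \<inter> T = {}" for D T R
  have many: "2 ^ ?n \<le> 2 ^ (c + 2) * card {R. R \<subseteq> S \<and> good D T R}" if "D \<in> S" "T \<in> ?I D" for D T
  proof -
    have T: "T \<subseteq> S" "D \<notin> T" "card T = c" using that by (auto simp: boundary_depth_sets_def)
    have bT: "b D T \<in> S - T" using b(1) that by blast
    have "card {R. R \<subseteq> S \<and> good D T R} = 2 ^ (?n - card {D, b D T} - card T)"
      unfolding good_def using T bT that by (intro card_subsets_containing_avoiding fin) auto
    \<comment> \<open>An inequality, since the dummy choice \<open>b D T = D\<close> leaves only one
      required object.\<close>
    moreover have "card {D, b D T} \<le> 2" by (simp add: card_insert_if)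
    then have "?n \<le> (c + 2) + (?n - card {D, b D T} - card T)" using T by linarith
    then have "(2::nat) ^ ?n \<le> 2 ^ (c + 2) * 2 ^ (?n - card {D, b D T} - card T)"
      by (metis one_le_numeral power_add power_increasing)
    ultimately show ?thesis by simp
  qed
  have few: "real (\<Sum>D\<in>S. card {T\<in>?I D. good D T R}) \<le> u" if R: "R \<subseteq> S" for R
  proof (cases "R = {}")
    case True
    then show ?thesis using u(2) by (simp add: good_def)
  next
    case False
    have finR: "finite R" using R fin finite_subset by blast
    have "(\<Sum>D\<in>S. card {T\<in>?I D. good D T R}) = (\<Sum>D\<in>R. card {T\<in>?I D. good D T R})"
      using R fin by (intro sum.mono_neutral_right) (auto simp: good_def)
    also have "\<dots> \<le> (\<Sum>D\<in>R. card {e\<in>union_edges R. e \<subseteq> frontier D})"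
    proof (rule sum_mono)
      fix D assume D: "D \<in> R"
      have "{T\<in>?I D. good D T R} = {T\<in>?I D. T \<inter> R = {} \<and> b D T \<in> R}"
        using D by (auto simp: good_def)
      then show "card {T\<in>?I D. good D T R} \<le> card {e\<in>union_edges R. e \<subseteq> frontier D}"
        using b(2)[OF R D] by simp
    qed
    also have "\<dots> = card (\<Union>D\<in>R. {e\<in>union_edges R. e \<subseteq> frontier D})"
    proof (subst card_UN_disjoint[OF finR])
      show "\<forall>D\<in>R. finite {e\<in>union_edges R. e \<subseteq> frontier D}" using u(1)[OF R] by simp
      \<comment> \<open>An edge shared by two frontiers would consist of union vertices, but it is
        nonempty and free of vertices. Hence no edge is charged twice.\<close>
      have False if D: "D \<in> R" "D' \<in> R" "D \<noteq> D'" and e: "e \<in> union_edges R" "e \<subseteq> frontier D" "e \<subseteq> frontier D'"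
        for D D' e
      proof -
        obtain y where "y \<in> e" using e(1) in_components_nonempty by (auto simp: union_edges_def)
        moreover have "e \<subseteq> frontier (\<Union>R) - union_vertices R"
          using e(1) in_components_subset unfolding union_edges_def by blast
        ultimately show False using D e(2,3) unfolding union_vertices_def by blast
      qed
      then show "\<forall>D\<in>R. \<forall>D'\<in>R. D \<noteq> D' \<longrightarrow>
          {e\<in>union_edges R. e \<subseteq> frontier D} \<inter> {e\<in>union_edges R. e \<subseteq> frontier D'} = {}"
        by blast
    qed simp
    also have "\<dots> \<le> card (union_edges R)" using u(1)[OF R] by (intro card_mono) auto
    finally show ?thesis using u(3)[OF R False] by linarith
  qed
  have "2 ^ ?n * (\<Sum>D\<in>S. card (?I D)) = (\<Sum>D\<in>S. \<Sum>T\<in>?I D. 2 ^ ?n)"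
    by (simp add: sum_distrib_left mult.commute)
  also have "\<dots> \<le> (\<Sum>D\<in>S. \<Sum>T\<in>?I D. 2 ^ (c + 2) * card {R. R \<subseteq> S \<and> good D T R})"
    using many by (intro sum_mono) blast
  also have "\<dots> = 2 ^ (c + 2) * (\<Sum>D\<in>S. \<Sum>T\<in>?I D. card {R\<in>Pow S. good D T R})"
    by (simp add: sum_distrib_left)
  also have "(\<Sum>D\<in>S. \<Sum>T\<in>?I D. card {R\<in>Pow S. good D T R})
       = (\<Sum>D\<in>S. \<Sum>R\<in>Pow S. card {T\<in>?I D. good D T R})"
    using fI fin by (intro sum.cong refl sum_multicount_gen) auto
  also have "\<dots> = (\<Sum>R\<in>Pow S. \<Sum>D\<in>S. card {T\<in>?I D. good D T R})"
    by (rule sum.swap)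
  finally have "real (2 ^ ?n * (\<Sum>D\<in>S. card (?I D)))
      \<le> real (2 ^ (c + 2) * (\<Sum>R\<in>Pow S. \<Sum>D\<in>S. card {T\<in>?I D. good D T R}))"
    by (simp only: of_nat_le_iff)
  then have "2 ^ ?n * real (\<Sum>D\<in>S. card (?I D))
      \<le> 2 ^ (c + 2) * (\<Sum>R\<in>Pow S. real (\<Sum>D\<in>S. card {T\<in>?I D. good D T R}))"
    by simp
  also have "\<dots> \<le> 2 ^ (c + 2) * (\<Sum>R\<in>Pow S. u)"
    using few by (intro mult_left_mono sum_mono) auto
  also have "\<dots> = 2 ^ ?n * (2 ^ (c + 2) * u)" using fin by (simp add: card_Pow)
  finally show ?thesis by simp
qed

section \<open>From pairs with a private common point to boundary points\<close>

text \<open>Let \<open>W\<close> be the component of \<open>p\<close> in the complement of the other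
  objects. If \<open>W\<close> leaves the intersection of \<open>A\<close> and \<open>C\<close>, it
  crosses one of their frontiers at a point of depth two. Otherwise \<open>W\<close> is a bounded
  hole, and a generic point of its frontier lies on just one further object and still in
  \<open>A\<close> and \<open>C\<close>.\<close>

lemma depth_two_point_boundary:
  assumes fin: "finite S" and jr: "\<And>E. E \<in> S \<Longrightarrow> jordan_region E"
    and fr: "\<And>A B. A \<in> S \<Longrightarrow> B \<in> S \<Longrightarrow> A \<noteq> B \<Longrightarrow> finite (frontier A \<inter> frontier B)"
    and AC: "A \<noteq> C" "{E\<in>S. p \<in> E} = {A, C}"
  shows "(\<exists>y\<in>frontier A. {E\<in>S. y \<in> E} = {A, C}) \<or> (\<exists>y\<in>frontier C. {E\<in>S. y \<in> E} = {A, C})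
    \<or> (\<exists>D\<in>S - {A, C}. \<exists>y\<in>frontier D. {E\<in>S. y \<in> E} = {D, A, C})"
proof (rule ccontr)
  assume con: "\<not> ?thesis"
  have ACS: "A \<in> S" "C \<in> S" "p \<in> A" "p \<in> C" using AC by blast+
  have cl: "closed E" if "E \<in> S" for E using jr jordan_region_closed that by blast
  define X where "X = S - {A, C}"
  define V where "V = - \<Union>X"
  have finX: "finite X" using fin by (simp add: X_def)
  have clX: "closed (\<Union>X)" using finX cl by (intro closed_Union) (auto simp: X_def)
  have pV: "p \<in> V" using AC by (auto simp: V_def X_def)
  define W where "W = connected_component_set V p"
  have W: "p \<in> W" "connected W" "W \<subseteq> V" "open W"
    unfolding W_def using pV connected_component_subset[of V p]
    by (auto intro!: open_connected_component simp: V_def open_Compl clX)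
  have Wcomp: "W \<in> components V" using pV by (auto simp: W_def components_def)
  have WAC: "W \<subseteq> A \<inter> C"
  proof (rule ccontr)
    assume "\<not> ?thesis"
    then have "W \<inter> frontier (A \<inter> C) \<noteq> {}"
      using W ACS by (intro connected_Int_frontier) auto
    then obtain y where y: "y \<in> W" "y \<in> frontier (A \<inter> C)" by blast
    have "y \<in> A \<inter> C" using y(2) cl ACS frontier_subset_closed by (metis closed_Int subsetD)
    moreover have "y \<in> frontier A \<union> frontier C" using y(2) frontier_Int_subset by blast
    moreover have "y \<notin> E" if "E \<in> X" for E using that y W(3) by (auto simp: V_def)
    ultimately show False using con ACS unfolding X_def by blast
  qed
  have "bounded (A \<inter> C)" using jr ACS jordan_region_bounded by (simp add: bounded_Int)
  then have bd: "bounded (closure W)" using WAC bounded_closure bounded_subset by metis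
  have clAC: "closure W \<subseteq> A \<inter> C" using WAC cl ACS by (simp add: closure_minimal)
  \<comment> \<open>A plane minus a countable set is connected, so a hole with countable boundary would be unbounded.\<close>
  have "\<not> countable (frontier W)"
  proof
    assume "countable (frontier W)"
    then have "connected (- frontier W)"
      by (intro path_connected_imp_connected path_connected_complement_countable) auto
    moreover have "p \<in> - frontier W" using W by (simp add: frontier_def interior_open)
    ultimately have "- frontier W \<subseteq> W"
      using connected_Int_frontier[of "- frontier W" W] W(1) by blast
    then have "closure W = UNIV" by (auto simp: closure_Un_frontier)
    then show False using bd not_bounded_UNIV by auto
  qed
  \<comment> \<open>The crossings of the other boundaries are finite in number, so the uncountable
    frontier of \<open>W\<close> has a point that lies on at most one of these boundaries.\<close>
  moreover define B where "B = (\<Union>D\<in>X. \<Union>E\<in>X - {D}. frontier D \<inter> frontier E)"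
  have "countable B"
    unfolding B_def using finX fr by (intro countable_finite finite_UN_I) (auto simp: X_def)
  ultimately have "\<not> frontier W \<subseteq> B" using countable_subset by metis
  then obtain y where "y \<in> frontier W" "y \<notin> B" by blast
  then have y: "y \<in> frontier W"
     "\<And>D E. D \<in> X \<Longrightarrow> E \<in> X \<Longrightarrow> D \<noteq> E \<Longrightarrow> y \<in> frontier D \<Longrightarrow> y \<notin> frontier E"
    unfolding B_def by blast+
  have "y \<in> frontier V" using frontier_of_components_subset[OF Wcomp] y(1) by blast
  then have yX: "y \<in> frontier (\<Union>X)" by (simp add: V_def frontier_complement)
  then obtain D where D: "D \<in> X" "y \<in> frontier D" using frontier_Union_subset[OF finX] by blast
  have yAC: "y \<in> A" "y \<in> C" using y(1) clAC by (auto simp: frontier_def)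
  have "y \<in> D" using D cl frontier_subset_closed by (auto simp: X_def)
  moreover have "E = D" if "E \<in> X" "y \<in> E" for E
    \<comment> \<open>Since \<open>y\<close> is on the frontier of the union, each member of
      \<open>X\<close> containing it has it on its own frontier.\<close>
    using mem_frontier_Union_imp_mem_frontier[OF that yX] y(2)[OF D(1) that(1) _ D(2)] by blast
  ultimately have "{E\<in>S. y \<in> E} = {D, A, C}" using yAC ACS D(1) unfolding X_def by blast
  then show False using con D unfolding X_def by blast
qed

definition depth_two_pairs :: "'a set set \<Rightarrow> 'a set set set" where
  "depth_two_pairs S = {T. card T = 2 \<and> (\<exists>p. {E\<in>S. p \<in> E} = T)}"

text \<open>A pair is either \<open>insert D T\<close> with \<open>T\<close> a singleton, for a
  point on one of its own boundaries, or \<open>T\<close> itself, for a point on a third boundary.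
  These cases are \<open>c = 1\<close> and \<open>c = 2\<close>, and
  \<open>24 = 2 ^ 3 + 2 ^ 4\<close>.\<close>

lemma card_depth_two_pairs_le:
  fixes u :: real
  assumes fin: "finite S" and jr: "\<And>E. E \<in> S \<Longrightarrow> jordan_region E"
    and fr: "\<And>A B. A \<in> S \<Longrightarrow> B \<in> S \<Longrightarrow> A \<noteq> B \<Longrightarrow> finite (frontier A \<inter> frontier B)"
    and u: "\<And>R. R \<subseteq> S \<Longrightarrow> finite (union_edges R)" "0 \<le> u"
      "\<And>R. R \<subseteq> S \<Longrightarrow> R \<noteq> {} \<Longrightarrow> real (card (union_edges R)) \<le> u"
  shows "real (card (depth_two_pairs S)) \<le> 24 * u"
proof -
  define J where "J c = Sigma S (boundary_depth_sets S c)" for c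
  have J: "finite (J c)" "card (J c) = (\<Sum>D\<in>S. card (boundary_depth_sets S c D))" for c
    using fin finite_boundary_depth_sets[OF fin] by (auto simp: J_def)
  have "depth_two_pairs S \<subseteq> (\<lambda>(D, T). insert D T) ` J 1 \<union> snd ` J 2"
  proof
    fix T assume "T \<in> depth_two_pairs S"
    then obtain A C p where T: "T = {A, C}" "A \<noteq> C" "{E\<in>S. p \<in> E} = {A, C}"
      by (auto simp: depth_two_pairs_def card_2_iff)
    then have ACS: "A \<in> S" "C \<in> S" by blast+
    have "(\<exists>y\<in>frontier A. {E\<in>S. y \<in> E} = {A, C}) \<or> (\<exists>y\<in>frontier C. {E\<in>S. y \<in> E} = {A, C})
        \<or> (\<exists>D\<in>S - {A, C}. \<exists>y\<in>frontier D. {E\<in>S. y \<in> E} = {D, A, C})"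
      by (rule depth_two_point_boundary[OF fin jr fr T(2,3)])
    then consider (1) "\<exists>y\<in>frontier A. {E\<in>S. y \<in> E} = {A, C}"
      | (2) "\<exists>y\<in>frontier C. {E\<in>S. y \<in> E} = {A, C}"
      | (3) D where "D \<in> S - {A, C}" "\<exists>y\<in>frontier D. {E\<in>S. y \<in> E} = {D, A, C}"
      by (elim disjE bexE[where A = "S - {A, C}"])
    then show "T \<in> (\<lambda>(D, T). insert D T) ` J 1 \<union> snd ` J 2"
    proof cases
      case 1
      then have "{C} \<in> boundary_depth_sets S 1 A"
        using ACS T(2) by (simp add: boundary_depth_sets_def)
      then have "(A, {C}) \<in> J 1" using ACS by (simp add: J_def)
      from imageI[OF this, of "\<lambda>(D, T). insert D T"] show ?thesis using T(1) by simp
    next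
      case 2
      then have "{A} \<in> boundary_depth_sets S 1 C"
        using ACS T(2) by (simp add: boundary_depth_sets_def insert_commute)
      then have "(C, {A}) \<in> J 1" using ACS by (simp add: J_def)
      from imageI[OF this, of "\<lambda>(D, T). insert D T"] show ?thesis
        using T(1) by (simp add: insert_commute)
    next
      case 3
      then have "A \<noteq> D" "C \<noteq> D" by blast+
      with 3 have "{A, C} \<in> boundary_depth_sets S 2 D"
        using ACS T(2) by (simp add: boundary_depth_sets_def)
      then have "(D, {A, C}) \<in> J 2" using 3 by (simp add: J_def)
      from imageI[OF this, of snd] show ?thesis using T(1) by simp
    qed
  qed
  then have "card (depth_two_pairs S) \<le> card ((\<lambda>(D, T). insert D T) ` J 1 \<union> snd ` J 2)"
    using J(1) by (intro card_mono) auto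
  also have "\<dots> \<le> card (J 1) + card (J 2)"
    by (meson J(1) add_mono card_Un_le card_image_le le_trans)
  finally have "real (card (depth_two_pairs S)) \<le> real (card (J 1)) + real (card (J 2))"
    by linarith
  also have "\<dots> \<le> 2 ^ (1 + 2) * u + 2 ^ (2 + 2) * u"
    unfolding J(2) by (intro add_mono card_boundary_depth_sets_le[OF fin jr u])
  finally show ?thesis by simp
qed

section \<open>Random orderings and harmonic sums\<close>

lemma permutes_pair_onto:
  assumes "x \<in> M" "y \<in> M" "x \<noteq> y" "K \<subseteq> M" "card K = 2"
  obtains p where "p permutes M" "p ` {x, y} = K"
proof -
  obtain a b where K: "K = {a, b}" "a \<noteq> b" using assms(5) by (auto simp: card_2_iff)
  define y' where "y' = Transposition.transpose x a y"
  have y': "y' \<noteq> a" "y' \<in> M" using assms K by (auto simp: y'_def Transposition.transpose_def)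
  \<comment> \<open>The first transposition takes \<open>x\<close> to \<open>a\<close> and
    \<open>y\<close> to \<open>y'\<close>; the second takes \<open>y'\<close> to \<open>b\<close>
    and fixes \<open>a\<close>.\<close>
  define p where "p = Transposition.transpose y' b \<circ> Transposition.transpose x a"
  have "p permutes M" unfolding p_def using assms K y'
    by (intro permutes_compose permutes_swap_id) auto
  moreover have "p x = a" using y' K by (simp add: p_def Transposition.transpose_def)
  moreover have "p y = b" by (simp add: p_def flip: y'_def)
  ultimately show thesis using that K by simp
qed

lemma card_filter_eq_sum: "finite P \<Longrightarrow> card {x\<in>P. R x} = (\<Sum>x\<in>P. of_bool (R x))"
  by (simp add: sum_of_bool_eq Int_def)

text \<open>Permuting the \<open>i + 2\<close> positions in \<open>M\<close> leaves the subfamily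
  unchanged, so all pairs of these positions are hit by equally many orderings. One ordering hits at
  most \<open>w * (i + 2)\<close> of the \<open>(i + 2) * (i + 1) / 2\<close> pairs, which gives the
  fraction \<open>2 * w / (i + 1)\<close> for each pair.\<close>

lemma card_permutations_pair_le:
  fixes w :: real
  assumes e: "bij_betw e {..<n} X" and ij: "i < j" "j < n"
    and bound: "\<And>S. S \<subseteq> X \<Longrightarrow> real (card (\<D> S)) \<le> w * real (card S)"
    and finD: "\<And>S. S \<subseteq> X \<Longrightarrow> finite (\<D> S)"
  shows "real (card {p. p permutes {..<n} \<and> {e (p i), e (p j)} \<in> \<D> ((e \<circ> p) ` insert j {..i})})
    \<le> 2 * w * fact n / real (Suc i)" (is "real (card ?Q) \<le> _")
proof -
  define M where "M = insert j {..i}"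
  define \<K> where "\<K> = {K. K \<subseteq> M \<and> card K = 2}"
  define P where "P = {p. p permutes {..<n}}"
  define hit where "hit K p \<longleftrightarrow> (e \<circ> p) ` K \<in> \<D> ((e \<circ> p) ` M)" for K p
  have M: "M \<subseteq> {..<n}" "card M = i + 2" "finite M" using ij by (auto simp: M_def)
  have finP: "finite P" by (simp add: P_def finite_permutations)
  have cardP: "card P = fact n" by (simp add: P_def card_permutations)
  have fin\<K>: "finite \<K>" using M by (auto simp: \<K>_def)
  have Q: "?Q = {p\<in>P. hit {i, j} p}" by (auto simp: P_def hit_def M_def)
  have same: "card {p\<in>P. hit K p} = card ?Q" if K: "K \<in> \<K>" for K
  proof -
    obtain q where q: "q permutes M" "q ` {i, j} = K"
    proof (rule permutes_pair_onto[of i M j K])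
      show "i \<in> M" "j \<in> M" "i \<noteq> j" "K \<subseteq> M" "card K = 2"
        using ij K by (auto simp: \<K>_def M_def)
    qed
    have q': "q permutes {..<n}" using q(1) M(1) permutes_subset by blast
    have "hit {i, j} (p \<circ> q) \<longleftrightarrow> hit K p" for p
    proof -
      have "(e \<circ> (p \<circ> q)) ` A = (e \<circ> p) ` (q ` A)" for A by (simp only: image_comp comp_assoc)
      then show ?thesis unfolding hit_def using q(2) permutes_image[OF q(1)] by (simp only:)
    qed
    then have "(\<Sum>p\<in>P. of_bool (hit {i, j} p)) = (\<Sum>p\<in>P. of_bool (hit K p) :: nat)"
      unfolding P_def using sum_permutations_compose_right[OF q', of "\<lambda>p. of_bool (hit {i, j} p) :: nat"]
      by simp
    then show ?thesis unfolding Q using finP by (simp add: card_filter_eq_sum)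
  qed
  have few: "real (card {K\<in>\<K>. hit K p}) \<le> w * real (i + 2)" if "p \<in> P" for p
  proof -
    have "p permutes {..<n}" using that by (simp add: P_def)
    from bij_betw_trans[OF permutes_imp_bij[OF this] e]
    have inj: "inj_on (e \<circ> p) {..<n}" and img: "(e \<circ> p) ` {..<n} = X"
      by (simp_all only: bij_betw_def)
    have sub: "(e \<circ> p) ` M \<subseteq> X" using img M(1) by blast
    \<comment> \<open>Distinct pairs of positions carry distinct pairs of objects.\<close>
    have "card {K\<in>\<K>. hit K p} = card ((\<lambda>K. (e \<circ> p) ` K) ` {K\<in>\<K>. hit K p})"
    proof (rule card_image[symmetric], rule inj_on_subset[OF inj_on_image_Pow[OF inj]])
      show "{K\<in>\<K>. hit K p} \<subseteq> Pow {..<n}" using M(1) by (auto simp: \<K>_def)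
    qed
    also have "\<dots> \<le> card (\<D> ((e \<circ> p) ` M))"
      using finD[OF sub] by (intro card_mono) (auto simp: hit_def)
    finally have "real (card {K\<in>\<K>. hit K p}) \<le> w * real (card ((e \<circ> p) ` M))"
      using bound[OF sub] by linarith
    also have "card ((e \<circ> p) ` M) = i + 2"
      using card_image inj_on_subset[OF inj M(1)] M(2) by metis
    finally show ?thesis .
  qed
  have "card \<K> = (i + 2) choose 2" unfolding \<K>_def using n_subsets[OF M(3), of 2] M(2) by simp
  also have "\<dots> = (i + 2) * (i + 1) div 2" by (simp add: choose_two)
  finally have c: "2 * card \<K> = (i + 2) * (i + 1)" by simp
  have "card \<K> * card ?Q = (\<Sum>K\<in>\<K>. card {p\<in>P. hit K p})" using same by simp
  also have "\<dots> = (\<Sum>p\<in>P. card {K\<in>\<K>. hit K p})"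
    using fin\<K> finP by (intro sum_multicount_gen) auto
  finally have "real (card \<K>) * real (card ?Q) = (\<Sum>p\<in>P. real (card {K\<in>\<K>. hit K p}))"
    by (simp only: flip: of_nat_mult of_nat_sum)
  also have "\<dots> \<le> (\<Sum>p\<in>P. w * real (i + 2))" using few by (intro sum_mono)
  also have "\<dots> = fact n * (w * real (i + 2))" using cardP by simp
  finally have le: "2 * real (card \<K>) * real (card ?Q) \<le> 2 * fact n * (w * real (i + 2))" by simp
  have c': "2 * real (card \<K>) = real (i + 2) * real (i + 1)"
    using arg_cong[OF c, of real] by (simp only: of_nat_mult of_nat_numeral)
  have "real (i + 2) * (real (i + 1) * real (card ?Q)) \<le> real (i + 2) * (2 * w * fact n)"
    using le unfolding c' by (simp only: mult_ac)
  then have "real (i + 1) * real (card ?Q) \<le> 2 * w * fact n"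
    by (rule mult_left_le_imp_le) simp
  then show ?thesis by (simp add: field_simps)
qed

text \<open>Some ordering does no worse than the average. For fixed \<open>j\<close> the
  probabilities add up to a multiple of \<open>harm j\<close>, which is at most
  \<open>harm n\<close>, and there are \<open>n\<close> choices of \<open>j\<close>.\<close>

lemma ordering_with_few_pairs:
  fixes w :: real
  assumes finX: "finite X" and w: "0 \<le> w"
    and bound: "\<And>S. S \<subseteq> X \<Longrightarrow> real (card (\<D> S)) \<le> w * real (card S)"
    and finD: "\<And>S. S \<subseteq> X \<Longrightarrow> finite (\<D> S)"
  obtains e where "bij_betw e {..<card X} X"
    "real (card {(j, i). i < j \<and> j < card X \<and> {e i, e j} \<in> \<D> (e ` insert j {..i})})
      \<le> 2 * w * real (card X) * harm (card X)"
proof -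
  define n where "n = card X"
  obtain e where e: "bij_betw e {..<n} X"
    using ex_bij_betw_nat_finite[OF finX] by (auto simp: n_def atLeast0LessThan)
  define P where "P = {p. p permutes {..<n}}"
  define Z where "Z = (SIGMA j:{..<n}. {..<j})"
  define hit where "hit p z \<longleftrightarrow> (case z of (j, i) \<Rightarrow> {e (p i), e (p j)} \<in> \<D> ((e \<circ> p) ` insert j {..i}))"
    for p :: "nat \<Rightarrow> nat" and z
  define B where "B = 2 * w * real n * harm n"
  have finP: "finite P" by (simp add: P_def finite_permutations)
  have cardP: "card P = fact n" by (simp add: P_def card_permutations)
  have finZ: "finite Z" by (auto simp: Z_def)
  have one: "real (card {p\<in>P. hit p z}) \<le> 2 * w * fact n / real (Suc (snd z))" if "z \<in> Z" for z
    using card_permutations_pair_le[OF e _ _ bound finD, of "snd z" "fst z"] that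
    by (auto simp: Z_def P_def hit_def)
  have "(\<Sum>p\<in>P. card {z\<in>Z. hit p z}) = (\<Sum>z\<in>Z. card {p\<in>P. hit p z})"
    using finP finZ by (intro sum_multicount_gen) auto
  then have "(\<Sum>p\<in>P. real (card {z\<in>Z. hit p z})) = (\<Sum>z\<in>Z. real (card {p\<in>P. hit p z}))"
    by (simp only: flip: of_nat_sum)
  also have "\<dots> \<le> (\<Sum>z\<in>Z. 2 * w * fact n / real (Suc (snd z)))"
    using one by (intro sum_mono)
  also have "\<dots> = (\<Sum>j<n. \<Sum>i<j. 2 * w * fact n / real (Suc i))"
    unfolding Z_def by (subst sum.Sigma) (auto simp: split_def)
  also have "\<dots> = (\<Sum>j<n. 2 * w * fact n * harm j)"
    by (simp only: harm_altdef sum_distrib_left divide_inverse)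
  also have "\<dots> \<le> (\<Sum>j<n. 2 * w * fact n * harm n)"
    using w by (intro sum_mono mult_left_mono harm_mono) auto
  also have "\<dots> = (\<Sum>p\<in>P. B)" by (simp add: cardP B_def)
  finally have le: "(\<Sum>p\<in>P. real (card {z\<in>Z. hit p z})) \<le> (\<Sum>p\<in>P. B)" .
  have "id \<in> P" using permutes_id by (simp add: P_def)
  then have ne: "P \<noteq> {}" by blast
  have "\<exists>p\<in>P. real (card {z\<in>Z. hit p z}) \<le> B"
  proof (rule ccontr)
    assume "\<not> ?thesis"
    then have "B < real (card {z\<in>Z. hit p z})" if "p \<in> P" for p
      using that by (simp add: not_le)
    then have "(\<Sum>p\<in>P. B) < (\<Sum>p\<in>P. real (card {z\<in>Z. hit p z}))"
      by (intro sum_strict_mono finP ne)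
    with le show False by simp
  qed
  then obtain p where p: "p \<in> P" "real (card {z\<in>Z. hit p z}) \<le> B" by blast
  show thesis
  proof (rule that[of "e \<circ> p"])
    show "bij_betw (e \<circ> p) {..<card X} X"
    proof (rule bij_betw_trans)
      show "bij_betw p {..<card X} {..<n}"
        using p(1) permutes_imp_bij by (simp add: P_def n_def)
    qed (rule e)
    have "{(j, i). i < j \<and> j < card X \<and> {(e \<circ> p) i, (e \<circ> p) j} \<in> \<D> ((e \<circ> p) ` insert j {..i})}
       = {z\<in>Z. hit p z}"
      by (auto simp: Z_def hit_def n_def)
    then show "real (card {(j, i). i < j \<and> j < card X \<and> {(e \<circ> p) i, (e \<circ> p) j} \<in> \<D> ((e \<circ> p) ` insert j {..i})})
      \<le> 2 * w * real (card X) * harm (card X)"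
      using p(2) by (simp add: B_def n_def)
  qed
qed

text \<open>The difference of \<open>harm n\<close> and \<open>ln n\<close> decreases from the value
  1 at \<open>n = 1\<close>. The factor 3 absorbs this 1, since \<open>ln n\<close> is at least 2/3
  from \<open>n = 2\<close> on.\<close>

lemma harm_le_ln:
  assumes "2 \<le> n"
  shows "harm n \<le> 3 * ln (real n)"
proof -
  have "harm (Suc (n - 1)) - ln (real (Suc (n - 1))) \<le> harm (Suc 0) - ln (real (Suc 0))"
    using decseq_harm_diff_ln by (rule decseqD) simp
  then have "harm n \<le> 1 + ln (real n)" using assms by (simp add: harm_expand)
  moreover have "2 / 3 \<le> ln (real n)"
    using ln2_ge_two_thirds assms ln_le_cancel_iff[of 2 "real n"] by linarith
  ultimately show ?thesis by linarith
qed

section \<open>The spanner and its size\<close>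

lemma hop_spanner_of_ordering:
  fixes e :: "nat \<Rightarrow> 'a set"
  assumes e: "bij_betw e {..<n} X"
  shows "hop_spanner 2 (intersection_graph_edges X)
    ((\<lambda>(j, i). {e i, e j}) ` {(j, i). i < j \<and> j < n \<and> {e i, e j} \<in> depth_two_pairs (e ` insert j {..i})})"
    (is "hop_spanner 2 _ ?H")
  unfolding hop_spanner_def
proof (intro conjI allI impI)
  have eX: "e i \<in> X" if "i < n" for i using e that by (auto simp: bij_betw_def)
  have inj: "e i = e j \<longleftrightarrow> i = j" if "i < n" "j < n" for i j
    using e that by (auto simp: bij_betw_def inj_on_def)
  show "?H \<subseteq> intersection_graph_edges X"
  proof
    fix T assume "T \<in> ?H"
    then obtain i j where ij: "i < j" "j < n" "T = {e i, e j}" "T \<in> depth_two_pairs (e ` insert j {..i})"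
      by auto
    then obtain q where "{E \<in> e ` insert j {..i}. q \<in> E} = {e i, e j}"
      by (auto simp: depth_two_pairs_def)
    then have "q \<in> e i \<inter> e j" by blast
    moreover have i: "i < n" using ij(1,2) by simp
    moreover have "e i \<noteq> e j" using inj[OF i ij(2)] ij(1) by simp
    ultimately show "T \<in> intersection_graph_edges X"
      using eX[OF i] eX[OF ij(2)] ij(3) unfolding intersection_graph_edges_def by blast
  qed
  fix u v assume "{u, v} \<in> intersection_graph_edges X"
  then have uv: "u \<in> X" "v \<in> X" "u \<noteq> v" "u \<inter> v \<noteq> {}"
    unfolding intersection_graph_edges_def by (auto simp: doubleton_eq_iff)
  then obtain q where q: "q \<in> u" "q \<in> v" by blast
  \<comment> \<open>The first object containing \<open>q\<close> is the midpoint of the path: a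
    later object containing \<open>q\<close>, put next to the objects up to index \<open>i\<close>,
    shares \<open>q\<close> with \<open>e i\<close> alone.\<close>
  define i where "i = (LEAST i. i < n \<and> q \<in> e i)"
  have ex: "\<exists>a<n. e a = x" if "x \<in> X" for x using e that by (auto simp: bij_betw_def)
  then have "\<exists>i. i < n \<and> q \<in> e i" using uv q by metis
  then have i: "i < n" "q \<in> e i" unfolding i_def by (metis (mono_tags, lifting) LeastI)+
  have least: "i \<le> a" if "a < n" "q \<in> e a" for a unfolding i_def using that by (simp add: Least_le)
  have edge: "{e i, x} \<in> ?H" if x: "x \<in> X" "q \<in> x" "x \<noteq> e i" for x
  proof -
    obtain j where j: "j < n" "e j = x" using ex x by blast
    then have ij: "i < j" using least x by (metis le_neq_implies_less)
    have "{E \<in> e ` insert j {..i}. q \<in> E} = {e i, e j}"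
    proof
      show "{E \<in> e ` insert j {..i}. q \<in> E} \<subseteq> {e i, e j}"
      proof
        fix E assume "E \<in> {E \<in> e ` insert j {..i}. q \<in> E}"
        then obtain a where a: "a = j \<or> a \<le> i" "E = e a" "q \<in> e a" by auto
        then have "a = j \<or> a = i" using least[of a] i(1) by linarith
        then show "E \<in> {e i, e j}" using a(2) by blast
      qed
    qed (use i x j in auto)
    moreover have "card {e i, e j} = 2" using j x by auto
    ultimately have "{e i, e j} \<in> depth_two_pairs (e ` insert j {..i})"
      unfolding depth_two_pairs_def by blast
    then show ?thesis using ij j by force
  qed
  \<comment> \<open>If \<open>u\<close> or \<open>v\<close> is the midpoint itself, a single spanner
    edge joins them.\<close>
  consider "u = e i" | "v = e i" | "u \<noteq> e i" "v \<noteq> e i" by blast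
  then show "\<exists>p. p \<noteq> [] \<and> hd p = u \<and> last p = v \<and> length p \<le> 2 + 1 \<and>
      (\<forall>k. Suc k < length p \<longrightarrow> {p ! k, p ! Suc k} \<in> ?H)"
  proof cases
    case 1
    then have "{u, v} \<in> ?H" using edge[of v] uv q by simp
    then show ?thesis by (intro exI[of _ "[u, v]"]) simp
  next
    case 2
    then have "{u, v} \<in> ?H" using edge[of u] uv q by (simp add: insert_commute)
    then show ?thesis by (intro exI[of _ "[u, v]"]) simp
  next
    case 3
    then have "{u, e i} \<in> ?H" "{e i, v} \<in> ?H"
      using edge[of u] edge[of v] uv q by (simp_all add: insert_commute)
    then show ?thesis
      by (intro exI[of _ "[u, e i, v]"]) (simp add: less_Suc_eq all_conj_distrib nth_Cons')
  qed
qed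

theorem theorem17:
  fixes F :: "complex set set" and U :: "nat \<Rightarrow> real"
  assumes wb: "well_behaved F"
    and uc: "\<And>X. X \<subseteq> F \<Longrightarrow> finite X \<Longrightarrow> union_complexity_le X (U (card X))"
    and mono: "\<And>m n. 1 \<le> m \<Longrightarrow> m \<le> n \<Longrightarrow> U m / real m \<le> U n / real n"
  shows "\<exists>C::real. \<forall>X. X \<subseteq> F \<longrightarrow> finite X \<longrightarrow> card X \<ge> 2 \<longrightarrow>
           (\<exists>H. hop_spanner 2 (intersection_graph_edges X) H \<and>
                real (card H) \<le> C * U (card X) * ln (real (card X)))"
\<comment> \<open>\<open>144 = 24 * 2 * 3\<close>: the bound on depth-two pairs, the probability for
  a pair of positions, and the passage from \<open>harm\<close> to \<open>ln\<close>.\<close>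
proof (intro exI[of _ 144] allI impI)
  fix X assume X: "X \<subseteq> F" "finite X" "2 \<le> card X"
  define n where "n = card X"
  define r where "r = U n / real n"
  have n: "2 \<le> n" using X by (simp add: n_def)
  have U0: "0 \<le> U n" using uc[OF X(1,2)] by (simp add: union_complexity_le_def n_def)
  then have r0: "0 \<le> r" by (simp add: r_def)
  have edges: "finite (union_edges R)" "real (card (union_edges R)) \<le> U (card R)" if "R \<subseteq> X" for R
  proof -
    have "union_complexity_le R (U (card R))" using uc that X finite_subset by (metis subset_trans)
    then show "finite (union_edges R)" "real (card (union_edges R)) \<le> U (card R)"
      by (auto simp: union_complexity_le_def)
  qed
  have fin: "finite S" if "S \<subseteq> X" for S using that X finite_subset by blast
  \<comment> \<open>Monotonicity of \<open>U m / m\<close> replaces \<open>U\<close> by the linear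
    bound with slope \<open>r = U n / n\<close> on all nonempty subfamilies, the form that the
    averaging over orderings requires.\<close>
  have Ule: "U (card R) \<le> r * real (card R)" if "R \<subseteq> X" "R \<noteq> {}" for R
  proof -
    have c: "1 \<le> card R" using that fin[OF that(1)] by (simp add: Suc_le_eq card_gt_0_iff)
    have "card R \<le> n" using that X by (simp add: card_mono n_def)
    from mono[OF c this] show ?thesis using c by (simp add: r_def divide_le_eq)
  qed
  have bound: "real (card (depth_two_pairs S)) \<le> 24 * r * real (card S)" if S: "S \<subseteq> X" for S
  proof -
    have "real (card (depth_two_pairs S)) \<le> 24 * (r * real (card S))"
    proof (rule card_depth_two_pairs_le[OF fin[OF S]])
      show "jordan_region E" if "E \<in> S" for E
        using that S X wb by (auto simp: well_behaved_def)
      show "finite (frontier A \<inter> frontier B)" if "A \<in> S" "B \<in> S" "A \<noteq> B" for A B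
        using that S X wb unfolding well_behaved_def by blast
      show "finite (union_edges R)" if "R \<subseteq> S" for R using that S edges by blast
      show "0 \<le> r * real (card S)" using r0 by simp
      show "real (card (union_edges R)) \<le> r * real (card S)" if R: "R \<subseteq> S" "R \<noteq> {}" for R
      proof -
        have "real (card (union_edges R)) \<le> r * real (card R)"
          using edges(2)[of R] Ule[of R] R S by force
        also have "\<dots> \<le> r * real (card S)"
          using R fin[OF S] r0 by (intro mult_left_mono) (auto intro: card_mono)
        finally show ?thesis .
      qed
    qed
    then show ?thesis by simp
  qed
  have finD: "finite (depth_two_pairs S)" if "S \<subseteq> X" for S
    by (rule finite_subset[of _ "Pow S"]) (use fin[OF that] in \<open>auto simp: depth_two_pairs_def\<close>)
  obtain e where e: "bij_betw e {..<n} X"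
    "real (card {(j, i). i < j \<and> j < n \<and> {e i, e j} \<in> depth_two_pairs (e ` insert j {..i})})
      \<le> 2 * (24 * r) * real n * harm n"
    using ordering_with_few_pairs[of X "24 * r" depth_two_pairs] X(2) r0 bound finD
    unfolding n_def by auto
  define Z where "Z = {(j, i). i < j \<and> j < n \<and> {e i, e j} \<in> depth_two_pairs (e ` insert j {..i})}"
  define H where "H = (\<lambda>(j, i). {e i, e j}) ` Z"
  have "finite Z"
    by (rule finite_subset[of _ "{..<n} \<times> {..<n}"]) (auto simp: Z_def)
  then have "real (card H) \<le> real (card Z)" by (simp add: H_def card_image_le)
  also have "\<dots> \<le> 48 * U n * harm n" using e(2) n by (simp add: Z_def r_def)
  also have "\<dots> \<le> 48 * U n * (3 * ln (real n))"
    using U0 harm_le_ln[OF n] by (intro mult_left_mono) auto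
  finally have "real (card H) \<le> 144 * U n * ln (real n)" by simp
  moreover have "hop_spanner 2 (intersection_graph_edges X) H"
    unfolding H_def Z_def by (rule hop_spanner_of_ordering[OF e(1)])
  ultimately show "\<exists>H. hop_spanner 2 (intersection_graph_edges X) H \<and>
      real (card H) \<le> 144 * U (card X) * ln (real (card X))"
    unfolding n_def by blast
qed

end
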